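(* Let $n,p\ge 1$ be integers, let $\Sigma\in\mathcal{S}_p^{++}$, let $X_1,\dots,X_n$ be independent $\mathcal{N}_p(0,\Sigma)$ random vectors, and let $\Sigma_n=\frac1n\sum_{k=1}^n X_kX_k^T$. Let $A\in\mathcal{S}_p$ with $A\neq 0$, and let $K\in\,]0,1[$ be arbitrary. Then the random variable $\varphi_A(\Sigma_n-\Sigma)$ (respectively $\varphi_A(\Sigma-\Sigma_n)$) is centered and sub-exponential with parameters $$\left(\nu^2=\frac{2\|A\Sigma\|_F^2}{n(1-K)},\quad b=\frac{2\|A\Sigma\|_\infty}{nK}\right).$$ Therefore, $$\mathbb{P}\left[\varphi_A(\Sigma_n-\Sigma)\ge t_u\right]\le \exp\left(-\frac u4\right)\quad\text{for all }u>0,$$ where $$t_u=\max\left\{\sqrt{u}\,\frac{\|A\Sigma\|_F}{\sqrt{n(1-K)}},\; u\,\frac{\|A\Sigma\|_\infty}{nK}\right\}.$$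
   Context: $\mathcal{S}_p$ is the set of real symmetric $p\times p$ matrices and $\mathcal{S}_p^{++}$ the set of positive definite ones. For $A\in\mathcal{S}_p$ and a $p\times p$ matrix $B$, $\varphi_A(B)=\mathrm{Tr}(AB)$. $\|B\|_F=\sqrt{\mathrm{Tr}(BB^T)}$ is the Frobenius norm. $\|B\|_\infty$ denotes the largest absolute value of the eigenvalues of $B$ (for $A\in\mathcal{S}_p$ and $\Sigma\in\mathcal{S}_p^{++}$ the eigenvalues of $A\Sigma$ are real, being those of $\Sigma^{1/2}A\Sigma^{1/2}$). A centered real random variable $Z$ is sub-exponential with positive parameters $(\nu^2,b)$ if $\mathbb{E}[\exp(tZ)]\le \exp(\nu^2t^2/2)$ for all $|t|\le \frac1b$. *)

theory Defs
  imports "HOL-Probability.Probability"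
begin

definition symmetric_mat :: "real^'p^'p \<Rightarrow> bool" where
  "symmetric_mat A \<longleftrightarrow> transpose A = A"

definition pos_def_mat :: "real^'p^'p \<Rightarrow> bool" where
  "pos_def_mat S \<longleftrightarrow> symmetric_mat S \<and> (\<forall>x. x \<noteq> 0 \<longrightarrow> 0 < x \<bullet> (S *v x))"

definition phi :: "real^'p^'p \<Rightarrow> real^'p^'p \<Rightarrow> real" where
  "phi A B = trace (A ** B)"

definition frob_norm :: "real^'p^'p \<Rightarrow> real" where
  "frob_norm B = sqrt (trace (B ** transpose B))"

text \<open>
  Eigenvalues are taken over the complex numbers, so that \<^term>\<open>eigenvalues B\<close> is the full
  (nonempty, finite) spectrum also for a non-symmetric real matrix such as a product of
  two symmetric ones.
\<close>

definition eigenvalues :: "real^'p^'p \<Rightarrow> complex set" where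
  "eigenvalues B = {l. \<exists>v::complex^'p. v \<noteq> 0 \<and> (\<chi> i j. complex_of_real (B $ i $ j)) *v v = l *s v}"

definition eig_norm :: "real^'p^'p \<Rightarrow> real" where
  "eig_norm B = Max (cmod ` eigenvalues B)"

text \<open>
  The Lebesgue density of the centered Gaussian law with covariance matrix \<open>S\<close>;
  it is meant for positive definite \<open>S\<close> only.
\<close>

definition gauss_density :: "real^'p^'p \<Rightarrow> real^'p \<Rightarrow> real" where
  "gauss_density S x =
     exp (- (x \<bullet> (matrix_inv S *v x)) / 2) / sqrt ((2 * pi) ^ CARD('p) * det S)"

definition sample_cov :: "nat \<Rightarrow> (nat \<Rightarrow> 'a \<Rightarrow> real^'p) \<Rightarrow> 'a \<Rightarrow> real^'p^'p" where
  "sample_cov n X \<omega> =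
     (1 / real n) *\<^sub>R (\<Sum>k=1..n. \<chi> i j. X k \<omega> $ i * X k \<omega> $ j)"

definition centered :: "'a measure \<Rightarrow> ('a \<Rightarrow> real) \<Rightarrow> bool" where
  "centered M Z \<longleftrightarrow> integrable M Z \<and> integral\<^sup>L M Z = 0"

text \<open>
  The first parameter is the variance proxy \<open>\<nu>\<^sup>2\<close> itself, not its square root. Integrability of
  the exponential is required explicitly, since the Bochner integral of a non-integrable
  function is 0.
\<close>

definition sub_exponential :: "'a measure \<Rightarrow> ('a \<Rightarrow> real) \<Rightarrow> real \<Rightarrow> real \<Rightarrow> bool" where
  "sub_exponential M Z nu2 b \<longleftrightarrow>
     centered M Z \<and> 0 < nu2 \<and> 0 < b \<and>
     (\<forall>t. \<bar>t\<bar> \<le> 1 / b \<longrightarrow>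
        integrable M (\<lambda>\<omega>. exp (t * Z \<omega>)) \<and>
        (\<integral>\<omega>. exp (t * Z \<omega>) \<partial>M) \<le> exp (nu2 * t\<^sup>2 / 2))"

end

theory Submission
  imports Defs
begin

text \<open>
  A basis that is orthonormal for \<open>\<Sigma>\<close> and consists of eigenvectors of \<open>A \<Sigma>\<close> turns
  \<open>X\<^sup>T A X\<close> into \<open>\<Sum>\<^sub>i \<lambda>\<^sub>i z\<^sub>i\<^sup>2\<close> with independent standard normal \<open>z\<^sub>i\<close>, where the
  \<open>\<lambda>\<^sub>i\<close> are the eigenvalues of \<open>A \<Sigma>\<close>; so its Laplace transform at \<open>s\<close> is
  \<open>\<Prod>\<^sub>i (1 - 2 s \<lambda>\<^sub>i)\<close> to the power \<open>-1/2\<close>. The variance proxy comes from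
  \<open>- ln (1 - x) - x \<le> x\<^sup>2 / (2 (1 - K))\<close> for \<open>\<bar>x\<bar> \<le> K\<close> together with
  \<open>\<Sum>\<^sub>i \<lambda>\<^sub>i\<^sup>2 = Tr (A \<Sigma> A \<Sigma>) \<le> \<parallel>A \<Sigma>\<parallel>\<^sub>F\<^sup>2\<close>, and the tail bound is Chernoff's.
\<close>

section \<open>Simultaneous diagonalization of two quadratic forms\<close>

text \<open>The polynomial vanishes at t = 0, so 0 is a minimum and the derivative there, which is
  a, must be zero. This extracts first-order conditions from an extremum.\<close>

lemma nonneg_quadratic_imp_linear_zero:
  fixes a b :: real
  assumes "\<And>t. 0 \<le> t * a + t\<^sup>2 * b"
  shows "a = 0"
proof (rule DERIV_local_min[where f = "\<lambda>t. t * a + t\<^sup>2 * b" and x = 0 and d = 1])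
  show "((\<lambda>t. t * a + t\<^sup>2 * b) has_real_derivative a) (at 0)"
    by (auto intro!: derivative_eq_intros)
qed (use assms in auto)

text \<open>
  The eigenvector maximizes the Rayleigh quotient \<open>(T x \<bullet> S x) / (x \<bullet> S x)\<close> on the unit sphere of \<open>V\<close>.
\<close>

lemma selfadjoint_has_eigenvector:
  fixes S T :: "'v::euclidean_space \<Rightarrow> 'v"
  assumes S: "linear S" and T: "linear T"
    and sym: "\<And>x y. x \<bullet> S y = S x \<bullet> y"
    and pos: "\<And>x. x \<noteq> 0 \<Longrightarrow> 0 < x \<bullet> S x"
    and adj: "\<And>x y. T x \<bullet> S y = x \<bullet> S (T y)"
    and V: "subspace V" "V \<noteq> {0}" and inv: "T ` V \<subseteq> V"
  obtains v l where "v \<in> V" "v \<bullet> S v = 1" "T v = l *\<^sub>R v"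
proof -
  define R where "R x = (T x \<bullet> S x) / (x \<bullet> S x)" for x
  let ?K = "V \<inter> sphere 0 1"
  obtain a where "a \<in> V" "a \<noteq> 0"
    using V subspace_0 by blast
  then have ne: "?K \<noteq> {}"
    using subspace_scale[OF V(1), of a "1 / norm a"] by (auto intro!: exI[of _ "a /\<^sub>R norm a"] simp: divide_inverse)
  have "compact ?K"
    using closed_subspace[OF V(1)] by (simp add: closed_Int_compact)
  moreover have "continuous_on ?K R"
    unfolding R_def
  proof (intro continuous_intros linear_continuous_on S T linear_conv_bounded_linear[THEN iffD1] ballI)
    fix x assume "x \<in> ?K"
    then have "x \<noteq> 0" by auto
    from pos[OF this] show "x \<bullet> S x \<noteq> 0" by simp
  qed
  ultimately obtain v0 where v0: "v0 \<in> ?K" and max: "\<And>x. x \<in> ?K \<Longrightarrow> R x \<le> R v0"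
    using continuous_attains_sup[of ?K R] ne by blast
  define l where "l = R v0"
  have v0': "v0 \<in> V" "v0 \<noteq> 0" using v0 by auto
  \<comment> \<open>Clearing the denominator of R turns maximality of l into nonnegativity of a
    symmetric bilinear form on V with a zero at \<open>v0\<close>.\<close>
  define q where "q x y = l * (x \<bullet> S y) - T x \<bullet> S y" for x y
  have q_nonneg: "0 \<le> q x x" if "x \<in> V" for x
  proof (cases "x = 0")
    case False
    \<comment> \<open>R is homogeneous of degree 0, so its bound on the unit sphere extends to every
      nonzero vector of V.\<close>
    let ?y = "x /\<^sub>R norm x"
    have "?y \<in> ?K" using that False V(1) by (auto simp: subspace_scale)
    then have "R ?y \<le> l" using max l_def by blast
    moreover have "R ?y = R x"
      using False by (simp add: R_def linear_scale[OF S] linear_scale[OF T])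
    ultimately have "R x \<le> l" by simp
    then show ?thesis
      using pos[OF False] by (simp add: q_def R_def pos_divide_le_eq)
  qed (simp add: q_def linear_0[OF S])
  have q0: "q v0 v0 = 0"
    using pos[OF v0'(2)] by (simp add: q_def l_def R_def)
  have qsym: "q x y = q y x" for x y
    unfolding q_def using sym adj by (metis inner_commute)
  \<comment> \<open>First variation: \<open>v0\<close> minimizes q on V, so q has no linear term at
    \<open>v0\<close> in any direction of V.\<close>
  have crit: "q v0 w = 0" if w: "w \<in> V" for w
  proof -
    have "0 \<le> t * (2 * q v0 w) + t\<^sup>2 * q w w" for t
    proof -
      have "0 \<le> q (v0 + t *\<^sub>R w) (v0 + t *\<^sub>R w)"
        using w v0' V(1) by (intro q_nonneg) (auto intro!: subspace_add subspace_scale)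
      also have "\<dots> = q v0 v0 + t * q v0 w + t * q w v0 + t\<^sup>2 * q w w"
        by (simp add: q_def linear_add[OF S] linear_add[OF T] linear_scale[OF S] linear_scale[OF T]
            inner_add_left inner_add_right algebra_simps power2_eq_square)
      finally show ?thesis using q0 qsym[of w v0] by simp
    qed
    then show ?thesis
      using nonneg_quadratic_imp_linear_zero by fastforce
  qed
  \<comment> \<open>The residual of the eigenvector equation is itself an admissible direction,
    because V is T-invariant; testing with it gives \<open>r \<bullet> S r = 0\<close>, and S is
    positive definite.\<close>
  define r where "r = l *\<^sub>R v0 - T v0"
  have "r \<in> V"
    unfolding r_def using v0' V(1) inv by (auto intro!: subspace_diff subspace_scale)
  from crit[OF this] have "r \<bullet> S r = 0"
    by (simp add: q_def r_def inner_diff_left)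
  then have eig: "T v0 = l *\<^sub>R v0"
    using pos[of r] unfolding r_def by fastforce
  let ?c = "1 / sqrt (v0 \<bullet> S v0)"
  show ?thesis
  proof
    show "?c *\<^sub>R v0 \<in> V" using v0' V(1) by (simp add: subspace_scale)
    show "(?c *\<^sub>R v0) \<bullet> S (?c *\<^sub>R v0) = 1"
      using pos[OF v0'(2)] by (simp add: linear_scale[OF S] divide_simps)
    show "T (?c *\<^sub>R v0) = l *\<^sub>R (?c *\<^sub>R v0)"
      using eig by (simp add: linear_scale[OF T])
  qed
qed

text \<open>Induction on the dimension of V: split off one normalized eigenvector v and pass to its
  complement in V with respect to the form \<open>x \<bullet> S y\<close>. Self-adjointness of T for
  this form keeps the complement T-invariant.\<close>

lemma selfadjoint_eigenbasis:
  fixes S T :: "'v::euclidean_space \<Rightarrow> 'v"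
  assumes S: "linear S" and T: "linear T"
    and sym: "\<And>x y. x \<bullet> S y = S x \<bullet> y"
    and pos: "\<And>x. x \<noteq> 0 \<Longrightarrow> 0 < x \<bullet> S x"
    and adj: "\<And>x y. T x \<bullet> S y = x \<bullet> S (T y)"
    and V: "subspace V" and inv: "T ` V \<subseteq> V"
  shows "\<exists>B. independent B \<and> span B = V \<and>
    (\<forall>x\<in>B. \<forall>y\<in>B. x \<bullet> S y = (if x = y then 1 else 0)) \<and> (\<forall>x\<in>B. \<exists>l. T x = l *\<^sub>R x)"
  using V inv
proof (induction "dim V" arbitrary: V rule: less_induct)
  case less
  show ?case
  proof (cases "V = {0}")
    case True
    then show ?thesis by (intro exI[of _ "{}"]) (auto simp: independent_empty)
  next
    case False
    obtain v l where v: "v \<in> V" "v \<bullet> S v = 1" "T v = l *\<^sub>R v"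
      using selfadjoint_has_eigenvector[OF S T sym pos adj less.prems(1) False less.prems(2)] by blast
    let ?W = "{x \<in> V. x \<bullet> S v = 0}"
    have W: "subspace ?W"
      using less.prems(1) unfolding subspace_def by (auto simp: inner_add_left)
    have "T ` ?W \<subseteq> ?W"
      using less.prems(2) v(3) adj by (auto simp: linear_scale[OF S])
    moreover have "dim ?W < dim V"
    proof (rule dim_psubset)
      have "v \<in> V - ?W" using v(1,2) by simp
      then have "?W \<subset> V" by blast
      then show "span ?W \<subset> span V"
        unfolding span_eq_iff[THEN iffD2, OF W] span_eq_iff[THEN iffD2, OF less.prems(1)] .
    qed
    ultimately obtain B where B: "independent B" "span B = ?W"
        "\<forall>x\<in>B. \<forall>y\<in>B. x \<bullet> S y = (if x = y then 1 else 0)" "\<forall>x\<in>B. \<exists>l. T x = l *\<^sub>R x"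
      using less.hyps[OF _ W] by blast
    have BW: "B \<subseteq> ?W" using B(2) span_superset by blast
    have "independent (insert v B)"
      using B(1,2) v(2) by (intro independent_insertI) auto
    moreover have "span (insert v B) = V"
    proof
      show "span (insert v B) \<subseteq> V"
        using BW v(1) less.prems(1) by (intro span_minimal) auto
      show "V \<subseteq> span (insert v B)"
      proof
        \<comment> \<open>Subtracting the component along v with respect to the S-form lands in the
          complement, which B spans.\<close>
        fix x assume "x \<in> V"
        then have "x - (x \<bullet> S v) *\<^sub>R v \<in> span B"
          using v(1,2) unfolding B(2)
          by (simp add: inner_diff_left subspace_diff[OF less.prems(1)] subspace_scale[OF less.prems(1)])
        then show "x \<in> span (insert v B)"
          unfolding span_insert by blast
      qed
    qed
    moreover have "\<forall>x\<in>insert v B. \<forall>y\<in>insert v B. x \<bullet> S y = (if x = y then 1 else 0)"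
    proof (intro ballI)
      have "x \<bullet> S v = 0" "v \<bullet> S x = 0" if "x \<in> B" for x
        using that BW sym[of x v] by (auto simp: inner_commute)
      moreover have "v \<notin> B" using BW v(2) by auto
      ultimately show "x \<bullet> S y = (if x = y then 1 else 0)" if "x \<in> insert v B" "y \<in> insert v B" for x y
        using that B(3) v(2) by auto
    qed
    moreover have "\<forall>x\<in>insert v B. \<exists>l. T x = l *\<^sub>R x" using B(4) v(3) by auto
    ultimately show ?thesis by blast
  qed
qed

lemma symmetric_mat_inner:
  assumes "symmetric_mat S"
  shows "x \<bullet> (S *v y) = (S *v x) \<bullet> y"
  using assms unfolding symmetric_mat_def
  by (metis dot_lmul_matrix vector_transpose_matrix)

text \<open>The product A S need not be symmetric, but it is self-adjoint for the inner product
  given by S: moving A and S across the dot product shows that both sides of the adjointness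
  condition equal \<open>(S *v x) \<bullet> (A *v (S *v y))\<close>.\<close>

lemma simultaneous_diagonalization:
  fixes S A :: "real^'p^'p"
  assumes S: "pos_def_mat S" and A: "symmetric_mat A"
  obtains b :: "'p \<Rightarrow> real^'p" and l :: "'p \<Rightarrow> real"
  where "\<And>i j. b i \<bullet> (S *v b j) = (if i = j then 1 else 0)"
    and "\<And>i. A *v (S *v b i) = l i *\<^sub>R b i"
    and "span (range b) = UNIV"
proof -
  have symS: "symmetric_mat S" using S by (simp add: pos_def_mat_def)
  have "\<exists>B. independent B \<and> span B = UNIV \<and>
      (\<forall>x\<in>B. \<forall>y\<in>B. x \<bullet> (S *v y) = (if x = y then 1 else 0)) \<and> (\<forall>x\<in>B. \<exists>l. A *v (S *v x) = l *\<^sub>R x)"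
  proof (rule selfadjoint_eigenbasis)
    show "linear (\<lambda>x. A *v (S *v x))"
      using linear_compose[of "(*v) S" "(*v) A"] by (simp add: comp_def)
    show "0 < x \<bullet> (S *v x)" if "x \<noteq> 0" for x using S that by (simp add: pos_def_mat_def)
  qed (auto simp: symmetric_mat_inner[OF symS] symmetric_mat_inner[OF A])
  then obtain B where B: "independent B" "span B = UNIV"
      "\<forall>x\<in>B. \<forall>y\<in>B. x \<bullet> (S *v y) = (if x = y then 1 else 0)" "\<forall>x\<in>B. \<exists>l. A *v (S *v x) = l *\<^sub>R x"
    by blast
  \<comment> \<open>The basis has as many elements as there are coordinates, so it can be indexed by
    the type \<open>'p\<close> itself.\<close>
  have "card B = card (UNIV :: 'p set)"
    using basis_card_eq_dim[of B UNIV] B by simp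
  moreover have "finite B" using B(1) independent_imp_finite by blast
  ultimately obtain b where b: "bij_betw b (UNIV :: 'p set) B"
    using finite_same_card_bij[of "UNIV :: 'p set" B] by auto
  then have bB: "b i \<in> B" for i by (auto simp: bij_betw_def)
  have "\<forall>i. \<exists>c. A *v (S *v b i) = c *\<^sub>R b i"
    using B(4) bB by simp
  then obtain l where "\<And>i. A *v (S *v b i) = l i *\<^sub>R b i"
    by metis
  moreover have "b i \<bullet> (S *v b j) = (if i = j then 1 else 0)" for i j
  proof -
    have "b i = b j \<longleftrightarrow> i = j" using b by (simp add: bij_betw_def inj_eq)
    then show ?thesis using B(3)[rule_format, OF bB bB, of i j] by simp
  qed
  moreover have "span (range b) = UNIV" using b B(2) by (simp add: bij_betw_def)
  ultimately show ?thesis using that by blast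
qed

section \<open>Scalar inequalities for the logarithm\<close>

text \<open>The right side minus the left side is h, whose derivative
  \<open>y * (K - y) / ((1 - K) * (1 - y))\<close> has the sign of y for y between -K and K. So h is
  smallest at 0, where it vanishes.\<close>

lemma neg_ln_one_minus_le:
  fixes x K :: real
  assumes "\<bar>x\<bar> \<le> K" "K < 1"
  shows "- ln (1 - x) - x \<le> x\<^sup>2 / (2 * (1 - K))"
proof -
  define h where "h x = x\<^sup>2 / (2 * (1 - K)) + ln (1 - x) + x" for x :: real
  have K: "0 \<le> K" using assms by auto
  have d: "(h has_real_derivative y * (K - y) / ((1 - K) * (1 - y))) (at y)" if "y \<le> K" for y
  proof -
    have y: "1 - y \<noteq> 0" "1 - K \<noteq> 0" using that assms(2) by auto
    have "(h has_real_derivative (2 * y / (2 * (1 - K)) - 1 / (1 - y) + 1)) (at y)"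
      unfolding h_def using that assms(2) by (auto intro!: derivative_eq_intros)
    also have "2 * y / (2 * (1 - K)) - 1 / (1 - y) + 1 = y * (K - y) / ((1 - K) * (1 - y))"
      using y by (simp add: divide_simps) (simp add: algebra_simps)
    finally show ?thesis .
  qed
  have "h 0 \<le> h x"
  proof (cases "0 \<le> x")
    case True
    show ?thesis
    proof (rule DERIV_nonneg_imp_nondecreasing[OF True])
      fix y assume "0 \<le> y" "y \<le> x"
      then have "y \<le> K" "0 \<le> y * (K - y) / ((1 - K) * (1 - y))"
        using assms by auto
      then show "\<exists>d. (h has_real_derivative d) (at y) \<and> 0 \<le> d" using d by blast
    qed
  next
    case False
    then have x: "x \<le> 0" by simp
    show ?thesis
    proof (rule DERIV_nonpos_imp_nonincreasing[OF x])
      fix y assume "x \<le> y" "y \<le> 0"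
      then have "y \<le> K" "y * (K - y) / ((1 - K) * (1 - y)) \<le> 0"
        using assms K by (auto intro!: divide_nonpos_nonneg mult_nonpos_nonneg)
      then show "\<exists>d. (h has_real_derivative d) (at y) \<and> d \<le> 0" using d by blast
    qed
  qed
  then show ?thesis by (simp add: h_def)
qed

text \<open>Half of the logarithmic bound, exponentiated. With x = 2 s \<lambda> the left side is
  the Laplace transform at s of \<lambda> (z^2 - 1) for a standard normal z.\<close>

lemma inverse_sqrt_one_minus_le:
  fixes x K :: real
  assumes "\<bar>x\<bar> \<le> K" "K < 1"
  shows "exp (- x / 2) / sqrt (1 - x) \<le> exp (x\<^sup>2 / (4 * (1 - K)))"
proof -
  have "0 < 1 - x" using assms by auto
  then have "1 / sqrt (1 - x) = exp (- ln (1 - x) / 2)"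
    by (simp add: exp_minus inverse_eq_divide flip: ln_sqrt)
  then have "exp (- x / 2) / sqrt (1 - x) = exp ((- ln (1 - x) - x) / 2)"
    by (simp add: divide_inverse[of "exp _"] inverse_eq_divide mult_exp_exp algebra_simps diff_divide_distrib)
  also have "\<dots> \<le> exp (x\<^sup>2 / (2 * (1 - K)) / 2)"
    using neg_ln_one_minus_le[OF assms] by (intro exp_le_cancel_iff[THEN iffD2] divide_right_mono) auto
  finally show ?thesis by simp
qed

section \<open>Sub-exponential variables: criterion and tail bound\<close>

text \<open>Stated with the nonnegative integral, the bound makes sense before any integrability is
  known, and its finiteness then supplies integrability.\<close>

lemma sub_exponentialI:
  assumes "prob_space M" and [measurable]: "Z \<in> borel_measurable M"
    and "0 < nu2" "0 < b"
    and mgf: "\<And>t. \<bar>t\<bar> \<le> 1 / b \<Longrightarrow>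
      (\<integral>\<^sup>+\<omega>. ennreal (exp (t * Z \<omega>)) \<partial>M) \<le> ennreal (exp (nu2 * t\<^sup>2 / 2))"
  shows "sub_exponential M Z nu2 b"
proof -
  interpret prob_space M by fact
  have int: "integrable M (\<lambda>\<omega>. exp (t * Z \<omega>))" if "\<bar>t\<bar> \<le> 1 / b" for t
    using mgf[OF that] by (intro integrableI_nonneg) (auto simp: le_less_trans)
  have le: "(\<integral>\<omega>. exp (t * Z \<omega>) \<partial>M) \<le> exp (nu2 * t\<^sup>2 / 2)" if "\<bar>t\<bar> \<le> 1 / b" for t
    using mgf[OF that] by (simp add: nn_integral_eq_integral[OF int[OF that]])
  \<comment> \<open>The exponentials at the two end points t = 1/b and t = -1/b dominate Z, by
    \<open>\<bar>y\<bar> \<le> exp y + exp (- y)\<close> at y = Z/b.\<close>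
  have intZ: "integrable M Z"
  proof (rule Bochner_Integration.integrable_bound)
    show "integrable M (\<lambda>\<omega>. b * (exp (1 / b * Z \<omega>) + exp (- (1 / b) * Z \<omega>)))"
      using int[of "1 / b"] int[of "- (1 / b)"] \<open>0 < b\<close> by auto
    have "\<bar>y\<bar> \<le> exp y + exp (- y)" for y :: real
      using exp_ge_add_one_self[of y] exp_ge_add_one_self[of "- y"] exp_gt_zero[of y] exp_gt_zero[of "- y"]
      by linarith
    from this[of "Z \<omega> / b" for \<omega>] have "\<bar>Z \<omega>\<bar> \<le> b * (exp (1 / b * Z \<omega>) + exp (- (1 / b) * Z \<omega>))" for \<omega>
      using \<open>0 < b\<close> by (simp add: field_simps)
    then show "AE \<omega> in M. norm (Z \<omega>) \<le> norm (b * (exp (1 / b * Z \<omega>) + exp (- (1 / b) * Z \<omega>)))"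
      by (intro AE_I2) (auto intro: order_trans[OF _ abs_ge_self])
  qed auto
  \<comment> \<open>\<open>1 + t E Z \<le> E (exp (t Z)) \<le> exp (nu2 t\<^sup>2 / 2)\<close> with equality at \<open>t = 0\<close> forces \<open>E Z = 0\<close>.\<close>
  have "- expectation Z = 0"
  proof (rule DERIV_local_min[where f = "\<lambda>t. exp (nu2 * t\<^sup>2 / 2) - 1 - t * expectation Z" and x = 0 and d = "1 / b"])
    show "((\<lambda>t. exp (nu2 * t\<^sup>2 / 2) - 1 - t * expectation Z) has_real_derivative - expectation Z) (at 0)"
      by (auto intro!: derivative_eq_intros)
    show "\<forall>t. \<bar>0 - t\<bar> < 1 / b \<longrightarrow> exp (nu2 * 0\<^sup>2 / 2) - 1 - 0 * expectation Z
        \<le> exp (nu2 * t\<^sup>2 / 2) - 1 - t * expectation Z"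
    proof (intro allI impI)
      fix t assume "\<bar>0 - t\<bar> < 1 / b"
      then have t: "\<bar>t\<bar> \<le> 1 / b" by simp
      have "1 + t * expectation Z = (\<integral>\<omega>. 1 + t * Z \<omega> \<partial>M)"
        using intZ by (simp add: prob_space)
      also have "\<dots> \<le> (\<integral>\<omega>. exp (t * Z \<omega>) \<partial>M)"
        using intZ by (intro integral_mono int t exp_ge_add_one_self) auto
      finally show "exp (nu2 * 0\<^sup>2 / 2) - 1 - 0 * expectation Z
          \<le> exp (nu2 * t\<^sup>2 / 2) - 1 - t * expectation Z"
        using le[OF t] by simp
    qed
  qed (use \<open>0 < b\<close> in auto)
  then show ?thesis
    using assms intZ int le by (simp add: sub_exponential_def centered_def)
qed

text \<open>The admissible range of t and the bound are invariant under t -> -t.\<close>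

lemma sub_exponential_uminus:
  assumes "sub_exponential M Z nu2 b"
  shows "sub_exponential M (\<lambda>\<omega>. - Z \<omega>) nu2 b"
proof -
  have "integrable M (\<lambda>\<omega>. exp (t * - Z \<omega>)) \<and>
      (\<integral>\<omega>. exp (t * - Z \<omega>) \<partial>M) \<le> exp (nu2 * t\<^sup>2 / 2)" if "\<bar>t\<bar> \<le> 1 / b" for t
    using assms that unfolding sub_exponential_def by (auto dest!: spec[of _ "- t"])
  then show ?thesis
    using assms by (auto simp: sub_exponential_def centered_def)
qed

text \<open>Chernoff's exponent nu2 s^2 / 2 - s t is minimal at s = t / nu2; if that leaves the
  admissible range, the end point s = 1/b is used. Each of the two terms of the maximum serves one
  of these cases.\<close>

lemma sub_exponential_tail:
  assumes "prob_space M" and sub: "sub_exponential M Z nu2 b" and "0 < v"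
  shows "measure M {\<omega> \<in> space M. Z \<omega> \<ge> max (sqrt (nu2 * v)) (b * v)} \<le> exp (- v / 2)"
proof -
  interpret prob_space M by fact
  let ?t = "max (sqrt (nu2 * v)) (b * v)"
  have nu2: "0 < nu2" and b: "0 < b" and [measurable]: "Z \<in> borel_measurable M"
    using sub by (auto simp: sub_exponential_def centered_def)
  have chernoff: "measure M {\<omega> \<in> space M. Z \<omega> \<ge> ?t} \<le> exp (nu2 * s\<^sup>2 / 2 - s * ?t)"
    if s: "0 < s" "s \<le> 1 / b" for s
  proof -
    have int: "integrable M (\<lambda>\<omega>. exp (s * Z \<omega>))"
      and le: "(\<integral>\<omega>. exp (s * Z \<omega>) \<partial>M) \<le> exp (nu2 * s\<^sup>2 / 2)"
      using sub s by (auto simp: sub_exponential_def)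
    have "measure M {\<omega> \<in> space M. Z \<omega> \<ge> ?t} \<le> measure M {\<omega> \<in> space M. exp (s * Z \<omega>) \<ge> exp (s * ?t)}"
      using s by (intro finite_measure_mono) auto
    also have "\<dots> \<le> (\<integral>\<omega>. exp (s * Z \<omega>) \<partial>M) / exp (s * ?t)"
      using int by (intro integral_Markov_inequality_measure[where A = "{}"]) auto
    also have "\<dots> \<le> exp (nu2 * s\<^sup>2 / 2) / exp (s * ?t)"
      using le by (intro divide_right_mono) auto
    finally show ?thesis by (simp add: exp_diff)
  qed
  have "0 \<le> nu2 * v" using nu2 \<open>0 < v\<close> by simp
  then have t2: "nu2 * v \<le> ?t\<^sup>2"
    by (metis max.cobounded1 power_mono real_sqrt_ge_zero real_sqrt_pow2)
  have tpos: "0 < ?t" using nu2 \<open>0 < v\<close> by (simp add: less_max_iff_disj)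
  show ?thesis
  proof (cases "?t * b \<le> nu2")
    \<comment> \<open>The unconstrained minimizer s = t / nu2 is admissible here and gives -t^2 / (2
      nu2); then \<open>t2\<close> applies.\<close>
    case True
    have "measure M {\<omega> \<in> space M. Z \<omega> \<ge> ?t} \<le> exp (nu2 * (?t / nu2)\<^sup>2 / 2 - ?t / nu2 * ?t)"
      using True nu2 b tpos by (intro chernoff) (auto simp: field_simps)
    also have "nu2 * (?t / nu2)\<^sup>2 / 2 - ?t / nu2 * ?t = - (?t\<^sup>2 / (2 * nu2))"
      using nu2 by (simp add: field_simps power2_eq_square)
    also have "\<dots> \<le> - v / 2"
      using t2 nu2 by (simp add: field_simps)
    finally show ?thesis by simp
  next
    \<comment> \<open>At s = 1/b, replacing nu2 by the larger t b leaves -t / (2 b), and t is at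
      least b v.\<close>
    case False
    have "measure M {\<omega> \<in> space M. Z \<omega> \<ge> ?t} \<le> exp (nu2 * (1 / b)\<^sup>2 / 2 - 1 / b * ?t)"
      using b by (intro chernoff) auto
    also have "nu2 * (1 / b)\<^sup>2 / 2 - 1 / b * ?t \<le> (?t * b) * (1 / b)\<^sup>2 / 2 - 1 / b * ?t"
      using False by (intro diff_right_mono divide_right_mono mult_right_mono) auto
    also have "\<dots> = - (?t / b) / 2"
      using b by (simp add: field_simps power2_eq_square)
    also have "\<dots> \<le> - v / 2"
      using b by (simp add: field_simps)
    finally show ?thesis by simp
  qed
qed

section \<open>Gaussian integrals and linear substitution\<close>

text \<open>The integrand is the normal density of variance 1/c without its normalizing
  constant.\<close>

lemma nn_integral_exp_quadratic:
  fixes c :: real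
  assumes "0 < c"
  shows "(\<integral>\<^sup>+z. ennreal (exp (- (c * z\<^sup>2 / 2))) \<partial>lborel) = ennreal (sqrt (2 * pi / c))"
proof -
  have "(\<integral>\<^sup>+z. ennreal (exp (- (c * z\<^sup>2 / 2))) \<partial>lborel)
      = (\<integral>\<^sup>+z. ennreal (sqrt (2 * pi / c)) * ennreal (normal_density 0 (1 / sqrt c) z) \<partial>lborel)"
    using assms by (intro nn_integral_cong)
       (simp add: normal_density_def power_divide real_sqrt_divide flip: ennreal_mult)
  also have "\<dots> = ennreal (sqrt (2 * pi / c))"
    using assms by (simp add: nn_integral_cmult nn_integral_eq_integral)
  finally show ?thesis .
qed

lemma nn_integral_exp_diagonal:
  fixes c :: "'p::finite \<Rightarrow> real"
  assumes "\<And>i. 0 < c i"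
  shows "(\<integral>\<^sup>+z. ennreal (exp (- ((\<Sum>i\<in>UNIV. c i * (z $ i)\<^sup>2) / 2))) \<partial>(lborel :: (real^'p) measure))
    = ennreal (\<Prod>i\<in>UNIV. sqrt (2 * pi / c i))"
proof -
  have inj: "inj (\<lambda>i. axis i (1::real))" by (auto simp: inj_on_def axis_eq_axis)
  have B: "Basis = range (\<lambda>i. axis i (1::real) :: real^'p)" by (auto simp: Basis_vec_def)
  \<comment> \<open>The product formula for \<open>lborel\<close> runs over basis vectors rather
    than indices; the choice operator recovers the index i from \<open>axis i 1\<close>.\<close>
  define f where "f e y = ennreal (exp (- c (SOME i. e = axis i 1) * y\<^sup>2 / 2))" for e :: "real^'p" and y :: real
  have [measurable]: "f e \<in> borel_measurable borel" for e
    unfolding f_def by measurable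
  have f_axis: "f (axis i 1) y = ennreal (exp (- c i * y\<^sup>2 / 2))" for i y
  proof -
    have "(SOME j. axis i (1::real) = axis j 1) = i" by (auto simp: axis_eq_axis)
    then show ?thesis by (simp add: f_def)
  qed
  have "ennreal (exp (- ((\<Sum>i\<in>UNIV. c i * (z $ i)\<^sup>2) / 2))) = (\<Prod>e\<in>Basis. f e (z \<bullet> e))" for z :: "real^'p"
    unfolding B by (simp add: prod.reindex[OF inj] f_axis inner_axis prod_ennreal
        exp_sum[symmetric] sum_negf sum_divide_distrib)
  then have "(\<integral>\<^sup>+z. ennreal (exp (- ((\<Sum>i\<in>UNIV. c i * (z $ i)\<^sup>2) / 2))) \<partial>(lborel :: (real^'p) measure))
      = (\<Prod>e\<in>(Basis :: (real^'p) set). \<integral>\<^sup>+y. f e y \<partial>lborel)"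
    by (simp only: , subst nn_integral_lborel_prod) auto
  also have "\<dots> = (\<Prod>i\<in>UNIV. ennreal (sqrt (2 * pi / c i)))"
    unfolding B by (simp add: prod.reindex[OF inj] nn_integral_exp_quadratic[OF assms] ext[of "f (axis _ 1)", OF f_axis])
  also have "\<dots> = ennreal (\<Prod>i\<in>UNIV. sqrt (2 * pi / c i))"
    by (intro prod_ennreal) (use assms in \<open>auto simp: less_imp_le\<close>)
  finally show ?thesis .
qed

text \<open>
  Uniqueness of translation-invariant measures, by Tonelli. It replaces the Jacobian determinant:
  with \<open>g\<close> the Gaussian density, whose total mass is known, the scaling factor of \<open>h\<close> cancels.
  (The library's change of variables formulas need a well-ordered index type.)
\<close>

lemma nn_integral_lborel_linear_image:
  fixes f g :: "'v::euclidean_space \<Rightarrow> ennreal" and h h' :: "'v \<Rightarrow> 'v"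
  assumes h: "linear h" and h': "\<And>y. h (h' y) = y"
    and [measurable]: "f \<in> borel_measurable borel" "g \<in> borel_measurable borel"
  shows "(\<integral>\<^sup>+z. f (h z) \<partial>lborel) * (\<integral>\<^sup>+y. g y \<partial>lborel)
    = (\<integral>\<^sup>+y. f y \<partial>lborel) * (\<integral>\<^sup>+z. g (- h z) \<partial>lborel)"
proof -
  have [measurable]: "h \<in> borel_measurable borel"
    using h by (intro borel_measurable_continuous_onI linear_continuous_on) (simp add: linear_conv_bounded_linear)
  have shift: "(\<integral>\<^sup>+z. F (a + z) \<partial>lborel) = (\<integral>\<^sup>+z. F z \<partial>lborel)"
    if [measurable]: "F \<in> borel_measurable borel" for F :: "'v \<Rightarrow> ennreal" and a
    using nn_integral_distr[of "(+) a" lborel borel F] lborel_distr_plus[of a] by simp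
  have "(\<integral>\<^sup>+z. f (h z) \<partial>lborel) * (\<integral>\<^sup>+y. g y \<partial>lborel)
      = (\<integral>\<^sup>+y. (\<integral>\<^sup>+z. f (h z) \<partial>lborel) * g y \<partial>lborel)"
    by (simp add: nn_integral_cmult)
  \<comment> \<open>Translating z by \<open>h' y\<close>, a preimage of y under h, adds y to the
    argument of f.\<close>
  also have "\<dots> = (\<integral>\<^sup>+y. (\<integral>\<^sup>+z. f (h z + y) * g y \<partial>lborel) \<partial>lborel)"
  proof (intro nn_integral_cong)
    fix y
    have "(\<integral>\<^sup>+z. f (h z) \<partial>lborel) = (\<integral>\<^sup>+z. f (h z + y) \<partial>lborel)"
      using shift[of "\<lambda>z. f (h z)" "h' y"] by (simp add: linear_add[OF h] h' add.commute)
    then show "(\<integral>\<^sup>+z. f (h z) \<partial>lborel) * g y = (\<integral>\<^sup>+z. f (h z + y) * g y \<partial>lborel)"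
      by (simp add: nn_integral_multc)
  qed
  also have "\<dots> = (\<integral>\<^sup>+z. (\<integral>\<^sup>+y. f (h z + y) * g y \<partial>lborel) \<partial>lborel)"
    by (rule lborel_pair.Fubini') measurable
  \<comment> \<open>After the exchange of integrals y is translated by h z, which frees f of z; a
    second translation of z by \<open>h' y\<close> below frees g of y, and the double integral
    factors.\<close>
  also have "\<dots> = (\<integral>\<^sup>+z. (\<integral>\<^sup>+y. f y * g (y - h z) \<partial>lborel) \<partial>lborel)"
    using shift[of "\<lambda>y. f y * g (y - h z)" "h z" for z] by (simp add: add.commute)
  also have "\<dots> = (\<integral>\<^sup>+y. (\<integral>\<^sup>+z. f y * g (y - h z) \<partial>lborel) \<partial>lborel)"
    by (rule lborel_pair.Fubini') measurable
  also have "\<dots> = (\<integral>\<^sup>+y. f y * (\<integral>\<^sup>+z. g (- h z) \<partial>lborel) \<partial>lborel)"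
  proof (intro nn_integral_cong)
    fix y
    have "(\<integral>\<^sup>+z. g (y - h z) \<partial>lborel) = (\<integral>\<^sup>+z. g (- h z) \<partial>lborel)"
      using shift[of "\<lambda>z. g (y - h z)" "h' y"] by (simp add: linear_add[OF h] h')
    then show "(\<integral>\<^sup>+z. f y * g (y - h z) \<partial>lborel) = f y * (\<integral>\<^sup>+z. g (- h z) \<partial>lborel)"
      by (simp add: nn_integral_cmult)
  qed
  finally show ?thesis by (simp add: nn_integral_multc)
qed

section \<open>Spectrum, traces and norms of the product matrix\<close>

text \<open>Orthonormality for S says that the vectors \<open>S *v b i\<close> form the dual basis
  of the \<open>b i\<close>: coordinates in one family are inner products with the other.\<close>

locale simultaneous_eigenbasis =
  fixes S A :: "real^'p^'p" and b :: "'p \<Rightarrow> real^'p" and l :: "'p \<Rightarrow> real"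
  assumes pos_def: "pos_def_mat S" and symmetric: "symmetric_mat A"
    and orthonormal: "b i \<bullet> (S *v b j) = (if i = j then 1 else 0)"
    and eigen: "A *v (S *v b i) = l i *\<^sub>R b i"
    and span_b: "span (range b) = UNIV"
begin

lemma sym_S: "symmetric_mat S"
  using pos_def by (simp add: pos_def_mat_def)

lemma eqI_b:
  assumes "\<And>i. b i \<bullet> x = b i \<bullet> y"
  shows "x = y"
proof -
  have "orthogonal (x - y) z" if "z \<in> range b" for z
    using that assms by (auto simp: orthogonal_def inner_diff_left inner_commute[of _ "b _"])
  then have "orthogonal (x - y) (x - y)"
    using orthogonal_to_span[of "x - y" "range b" "x - y"] unfolding span_b by blast
  then show ?thesis by (simp add: orthogonal_def)
qed

lemma expand_dual: "(\<Sum>i\<in>UNIV. (b i \<bullet> y) *\<^sub>R (S *v b i)) = y"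
  by (rule eqI_b) (simp add: inner_sum_right orthonormal if_distrib cong: if_cong)

lemma invertible_S: "invertible S"
proof -
  have "x = 0" if "S *v x = 0" for x
    using pos_def that unfolding pos_def_mat_def by (metis inner_zero_right less_irrefl)
  then show ?thesis
    by (simp add: invertible_left_inverse matrix_left_invertible_ker)
qed

lemma matrix_inv_S: "matrix_inv S *v (S *v x) = x"
proof -
  have "matrix_inv S ** S = mat 1"
    using someI_ex[OF invertible_S[unfolded invertible_def]] by (simp add: matrix_inv_def)
  then show ?thesis by (simp add: matrix_vector_mul_assoc)
qed

text \<open>Applying S to both sides reduces this to \<open>expand_dual\<close> at
  \<open>S *v y\<close>; S is then cancelled by its inverse.\<close>

lemma expand: "(\<Sum>i\<in>UNIV. ((S *v b i) \<bullet> y) *\<^sub>R b i) = y"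
proof -
  have "S *v (\<Sum>i\<in>UNIV. ((S *v b i) \<bullet> y) *\<^sub>R b i) = S *v y"
    using expand_dual[of "S *v y"]
    by (simp add: linear_sum[OF matrix_vector_mul_linear] linear_scale[OF matrix_vector_mul_linear] symmetric_mat_inner[OF sym_S])
  then show ?thesis by (metis matrix_inv_S)
qed

text \<open>The trace computed in a basis and its dual; on eigenvectors of M it becomes the sum of
  the eigenvalues.\<close>

lemma trace_eq: "trace M = (\<Sum>i\<in>UNIV. (S *v b i) \<bullet> (M *v b i))"
proof -
  have "trace M = (\<Sum>j\<in>UNIV. (M *v axis j 1) $ j)"
    by (simp add: trace_def matrix_vector_mul_component inner_axis)
  also have "\<dots> = (\<Sum>j\<in>UNIV. (M *v (\<Sum>i\<in>UNIV. ((S *v b i) \<bullet> axis j 1) *\<^sub>R b i)) $ j)"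
    by (simp only: expand)
  also have "\<dots> = (\<Sum>j\<in>UNIV. \<Sum>i\<in>UNIV. (S *v b i) $ j * (M *v b i) $ j)"
    by (simp add: linear_sum[OF matrix_vector_mul_linear] linear_scale[OF matrix_vector_mul_linear] inner_axis)
  also have "\<dots> = (\<Sum>i\<in>UNIV. (S *v b i) \<bullet> (M *v b i))"
    by (subst sum.swap) (simp add: inner_vec_def)
  finally show ?thesis .
qed

lemma eigen': "(A ** S) *v b i = l i *\<^sub>R b i"
  by (simp add: eigen flip: matrix_vector_mul_assoc)

lemma trace_AS: "trace (A ** S) = (\<Sum>i\<in>UNIV. l i)"
  by (simp add: trace_eq eigen' inner_commute orthonormal)

lemma trace_AS_squared: "trace ((A ** S) ** (A ** S)) = (\<Sum>i\<in>UNIV. (l i)\<^sup>2)"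
proof -
  have "((A ** S) ** (A ** S)) *v b i = (l i)\<^sup>2 *\<^sub>R b i" for i
    unfolding matrix_vector_mul_assoc[symmetric, of "A ** S" "A ** S"] eigen'
      linear_scale[OF matrix_vector_mul_linear, of "A ** S"]
    by (simp add: power2_eq_square)
  then show ?thesis
    by (simp add: trace_eq inner_commute orthonormal)
qed

text \<open>If all \<open>l i\<close> were zero, A would kill every \<open>S *v b i\<close>, and
  these span the space.\<close>

lemma eigenvalue_nonzero:
  assumes "A \<noteq> 0"
  obtains i where "l i \<noteq> 0"
proof -
  have "A *v y = 0" if "\<And>i. l i = 0" for y
  proof -
    have "A *v (\<Sum>i\<in>UNIV. (b i \<bullet> y) *\<^sub>R (S *v b i)) = 0"
      using that by (simp add: linear_sum[OF matrix_vector_mul_linear] linear_scale[OF matrix_vector_mul_linear] eigen)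
    then show ?thesis by (simp only: expand_dual)
  qed
  then show ?thesis
    using assms that matrix_eq[of A 0] by (metis matrix_vector_mult_0)
qed

text \<open>Real eigenvectors give one inclusion. For the other, a complex eigenvector v is paired
  with the real left eigenvectors \<open>S *v b i\<close>: a nonzero pairing forces its eigenvalue
  to be \<open>l i\<close>.\<close>

lemma eigenvalues_eq: "eigenvalues (A ** S) = (\<lambda>i. complex_of_real (l i)) ` UNIV"
proof
  show "(\<lambda>i. complex_of_real (l i)) ` UNIV \<subseteq> eigenvalues (A ** S)"
  proof clarify
    fix i
    let ?v = "\<chi> j. complex_of_real (b i $ j)"
    have "(\<Sum>k\<in>UNIV. (A ** S) $ j $ k * b i $ k) = l i * b i $ j" for j
      using arg_cong[OF eigen'[of i], of "\<lambda>x. x $ j"] by (simp add: matrix_vector_mult_def)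
    then have "(\<chi> j k. complex_of_real ((A ** S) $ j $ k)) *v ?v = complex_of_real (l i) *s ?v"
      by (simp add: vec_eq_iff matrix_vector_mult_def flip: of_real_mult of_real_sum)
    moreover have "b i \<noteq> 0"
      using orthonormal[of i i] by auto
    then have "?v \<noteq> 0"
      by (simp add: vec_eq_iff)
    ultimately show "complex_of_real (l i) \<in> eigenvalues (A ** S)"
      unfolding eigenvalues_def by blast
  qed
next
  show "eigenvalues (A ** S) \<subseteq> (\<lambda>i. complex_of_real (l i)) ` UNIV"
  proof
    fix c assume "c \<in> eigenvalues (A ** S)"
    then obtain v :: "complex^'p" where v: "v \<noteq> 0"
        "(\<chi> i j. complex_of_real ((A ** S) $ i $ j)) *v v = c *s v"
      unfolding eigenvalues_def by blast
    define u where "u i = S *v b i" for i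
    define d where "d i = (\<Sum>j\<in>UNIV. complex_of_real (u i $ j) * v $ j)" for i
    have left: "(\<Sum>j\<in>UNIV. u i $ j * (A ** S) $ j $ k) = l i * u i $ k" for i k
    proof -
      \<comment> \<open>Both matrices are symmetric, so the transpose is S A, and S A S b = l S
        b.\<close>
      have "transpose (A ** S) *v u i = l i *\<^sub>R u i"
        using sym_S symmetric unfolding u_def
        by (simp add: matrix_transpose_mul symmetric_mat_def eigen linear_scale[OF matrix_vector_mul_linear] flip: matrix_vector_mul_assoc)
      from arg_cong[OF this, of "\<lambda>x. x $ k"] show ?thesis
        by (simp add: matrix_vector_mult_def transpose_def mult.commute)
    qed
    have "c * d i = l i * d i" for i
    proof -
      have "c * d i = (\<Sum>j\<in>UNIV. complex_of_real (u i $ j) * (c *s v) $ j)"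
        by (simp add: d_def sum_distrib_left mult_ac)
      also have "\<dots> = (\<Sum>j\<in>UNIV. \<Sum>k\<in>UNIV. complex_of_real (u i $ j * (A ** S) $ j $ k) * v $ k)"
        unfolding v(2)[symmetric] by (simp add: matrix_vector_mult_def sum_distrib_left mult_ac)
      also have "\<dots> = (\<Sum>k\<in>UNIV. complex_of_real (\<Sum>j\<in>UNIV. u i $ j * (A ** S) $ j $ k) * v $ k)"
        by (subst sum.swap) (simp add: sum_distrib_right)
      also have "\<dots> = l i * d i"
        unfolding left by (simp add: d_def sum_distrib_left mult_ac)
      finally show ?thesis .
    qed
    moreover have "\<exists>i. d i \<noteq> 0"
    proof (rule ccontr)
      assume "\<not> ?thesis"
      then have d0: "d i = 0" for i by auto
      \<comment> \<open>Completeness of the dual pair of bases, entry by entry: if all pairings d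
        vanish, it reconstructs v as 0.\<close>
      have delta: "(\<Sum>i\<in>UNIV. u i $ j * b i $ k) = (if j = k then 1 else 0)" for j k
        using arg_cong[OF expand[of "axis j 1"], of "\<lambda>x. x $ k"]
        by (auto simp: u_def inner_axis) (auto simp: axis_def)
      have "v $ k = 0" for k
      proof -
        have "v $ k = (\<Sum>j\<in>UNIV. complex_of_real (if j = k then 1 else 0) * v $ j)"
          by (simp add: if_distrib if_distribR cong: if_cong)
        also have "\<dots> = (\<Sum>j\<in>UNIV. \<Sum>i\<in>UNIV. complex_of_real (u i $ j * b i $ k) * v $ j)"
          unfolding delta[symmetric] by (simp add: sum_distrib_right)
        also have "\<dots> = (\<Sum>i\<in>UNIV. complex_of_real (b i $ k) * d i)"
          by (subst sum.swap) (simp add: d_def sum_distrib_left mult_ac)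
        finally show ?thesis by (simp add: d0)
      qed
      then show False using v(1) by (simp add: vec_eq_iff)
    qed
    ultimately show "c \<in> (\<lambda>i. complex_of_real (l i)) ` UNIV" by auto
  qed
qed

lemma eig_norm_eq: "eig_norm (A ** S) = Max (range (\<lambda>i. \<bar>l i\<bar>))"
  by (simp add: eig_norm_def eigenvalues_eq image_image)

lemma abs_le_eig_norm: "\<bar>l i\<bar> \<le> eig_norm (A ** S)"
  unfolding eig_norm_eq by (intro Max_ge) auto

text \<open>The left side is Tr (B B) for B = A S. Each product of an entry with its mirror entry is
  at most the mean of their squares, and the sum of all squared entries is Tr (B B^T).\<close>

lemma sum_squares_le_frob_norm: "(\<Sum>i\<in>UNIV. (l i)\<^sup>2) \<le> (frob_norm (A ** S))\<^sup>2"
proof -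
  let ?B = "A ** S"
  have F: "trace (?B ** transpose ?B) = (\<Sum>i\<in>UNIV. \<Sum>j\<in>UNIV. (?B $ i $ j)\<^sup>2)"
    by (simp add: trace_def matrix_matrix_mult_def transpose_def power2_eq_square)
  have "trace (?B ** ?B) = (\<Sum>i\<in>UNIV. \<Sum>j\<in>UNIV. ?B $ i $ j * ?B $ j $ i)"
    by (simp add: trace_def matrix_matrix_mult_def[of ?B ?B])
  also have "\<dots> \<le> (\<Sum>i\<in>UNIV. \<Sum>j\<in>UNIV. ((?B $ i $ j)\<^sup>2 + (?B $ j $ i)\<^sup>2) / 2)"
  proof (intro sum_mono)
    fix i j
    show "?B $ i $ j * ?B $ j $ i \<le> ((?B $ i $ j)\<^sup>2 + (?B $ j $ i)\<^sup>2) / 2"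
      using sum_squares_bound[of "?B $ i $ j" "?B $ j $ i"] by simp
  qed
  also have "\<dots> = ((\<Sum>i\<in>UNIV. \<Sum>j\<in>UNIV. (?B $ i $ j)\<^sup>2) + (\<Sum>i\<in>UNIV. \<Sum>j\<in>UNIV. (?B $ j $ i)\<^sup>2)) / 2"
    by (simp add: sum.distrib flip: sum_divide_distrib)
  also have "\<dots> = trace (?B ** transpose ?B)"
    unfolding F using sum.swap[of "\<lambda>i j. (?B $ i $ j)\<^sup>2" UNIV UNIV] by simp
  finally have "(\<Sum>i\<in>UNIV. (l i)\<^sup>2) \<le> trace (?B ** transpose ?B)"
    by (simp only: trace_AS_squared)
  moreover have "0 \<le> trace (?B ** transpose ?B)"
    unfolding F by (intro sum_nonneg) auto
  ultimately show ?thesis by (simp add: frob_norm_def)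
qed

lemma inner_coordinates:
  "(\<Sum>i\<in>UNIV. z i *\<^sub>R (S *v b i)) \<bullet> (\<Sum>j\<in>UNIV. w j *\<^sub>R b j) = (\<Sum>i\<in>UNIV. z i * w i)"
  by (simp add: inner_sum_left inner_sum_right inner_commute[of "S *v _"] orthonormal if_distrib mult.commute cong: if_cong)

section \<open>Laplace transform of a Gaussian quadratic form\<close>

text \<open>The substitution x = h z, with z the coordinates in the dual basis, diagonalizes the
  density and the quadratic form at once. The condition on s keeps every diagonal coefficient
  \<open>1 - 2 * s * l i\<close> positive.\<close>

lemma mgf_quadratic_form:
  assumes norm: "(\<integral>\<^sup>+x. ennreal (gauss_density S x) \<partial>lborel) = 1"
    and s: "\<And>i. 2 * s * l i < 1"
  shows "(\<integral>\<^sup>+x. ennreal (gauss_density S x) * ennreal (exp (s * (x \<bullet> (A *v x)))) \<partial>lborel)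
    = ennreal (\<Prod>i\<in>UNIV. 1 / sqrt (1 - 2 * s * l i))"
proof -
  define N where "N = sqrt ((2 * pi) ^ CARD('p) * det S)"
  \<comment> \<open>If N were at most 0, division by it (with value 0 at N = 0) would make the
    density nonpositive, \<open>ennreal\<close> would send it to 0, and its mass could not be
    1.\<close>
  have N: "0 < N"
  proof (rule ccontr)
    assume "\<not> 0 < N"
    then have "gauss_density S x \<le> 0" for x
      unfolding gauss_density_def N_def[symmetric] by (intro divide_nonneg_nonpos) auto
    then show False using norm by (simp add: ennreal_neg)
  qed
  define h where "h z = (\<Sum>i\<in>UNIV. z $ i *\<^sub>R (S *v b i))" for z :: "real^'p"
  have lin: "linear h"
    unfolding h_def by (intro linear_compose_sum ballI linear_scale_left linearI)
       (auto simp: scaleR_add_left)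
  have inv: "h (\<chi> i. b i \<bullet> y) = y" for y
    by (simp add: h_def expand_dual)
  have dens: "gauss_density S (h z) = 1 / N * exp (- (\<Sum>i\<in>UNIV. 1 * (z $ i)\<^sup>2) / 2)" for z
  proof -
    have "matrix_inv S *v h z = (\<Sum>i\<in>UNIV. z $ i *\<^sub>R b i)"
      by (simp add: h_def linear_sum[OF matrix_vector_mul_linear] linear_scale[OF matrix_vector_mul_linear] matrix_inv_S)
    then show ?thesis
      by (simp add: gauss_density_def N_def h_def inner_coordinates power2_eq_square)
  qed
  have quad: "h z \<bullet> (A *v h z) = (\<Sum>i\<in>UNIV. l i * (z $ i)\<^sup>2)" for z
  proof -
    have "A *v h z = (\<Sum>i\<in>UNIV. (z $ i * l i) *\<^sub>R b i)"
      by (simp add: h_def linear_sum[OF matrix_vector_mul_linear] linear_scale[OF matrix_vector_mul_linear] eigen)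
    then show ?thesis
      by (simp add: h_def inner_coordinates power2_eq_square mult_ac)
  qed
  \<comment> \<open>The substitution identity evaluates the density at \<open>- h z\<close>.\<close>
  have even: "gauss_density S (- x) = gauss_density S x" for x
    by (simp add: gauss_density_def linear_neg[OF matrix_vector_mul_linear])
  have cont: "continuous_on UNIV ((*v) (M :: real^'p^'p))" for M
    by (intro linear_continuous_on) simp
  have [measurable]: "(*v) M \<in> borel_measurable borel" for M :: "real^'p^'p"
    by (intro borel_measurable_continuous_onI cont)
  have [measurable]: "gauss_density S \<in> borel_measurable borel"
    unfolding gauss_density_def by measurable
  define f where "f x = ennreal (gauss_density S x) * ennreal (exp (s * (x \<bullet> (A *v x))))" for x
  have fh: "f (h z) = ennreal (1 / N) * ennreal (exp (- (\<Sum>i\<in>UNIV. (1 - 2 * s * l i) * (z $ i)\<^sup>2) / 2))" for z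
  proof -
    have "(\<Sum>i\<in>UNIV. (1 - 2 * s * l i) * (z $ i)\<^sup>2)
      = (\<Sum>i\<in>UNIV. (z $ i)\<^sup>2) - 2 * s * (\<Sum>i\<in>UNIV. l i * (z $ i)\<^sup>2)"
      by (simp add: left_diff_distrib sum_subtractf sum_distrib_left mult.assoc)
    then have "- (\<Sum>i\<in>UNIV. 1 * (z $ i)\<^sup>2) / 2 + s * (\<Sum>i\<in>UNIV. l i * (z $ i)\<^sup>2)
      = - (\<Sum>i\<in>UNIV. (1 - 2 * s * l i) * (z $ i)\<^sup>2) / 2"
      by simp
    then show ?thesis
      using N by (simp add: f_def dens quad mult.assoc exp_add[symmetric] flip: ennreal_mult)
  qed
  have Ifh: "(\<integral>\<^sup>+z. f (h z) \<partial>lborel) = ennreal (1 / N) * ennreal (\<Prod>i\<in>UNIV. sqrt (2 * pi / (1 - 2 * s * l i)))"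
    unfolding fh using s by (subst nn_integral_cmult) (auto simp: nn_integral_exp_diagonal)
  have Igh: "(\<integral>\<^sup>+z. ennreal (gauss_density S (- h z)) \<partial>lborel)
      = ennreal (1 / N) * ennreal (\<Prod>i\<in>(UNIV :: 'p set). sqrt (2 * pi / 1))"
    unfolding even dens minus_divide_left[symmetric]
    using N by (simp only: ennreal_mult less_imp_le divide_nonneg_nonneg zero_le_one exp_ge_zero,
        subst nn_integral_cmult) (simp_all only: nn_integral_exp_diagonal zero_less_one, auto)
  \<comment> \<open>Since the density has mass 1, the integral of f times that of the density along
    h equals the integral of f along h. Both integrals along h are diagonal, and 1/N and the powers
    of 2 pi cancel.\<close>
  have "(\<integral>\<^sup>+z. f (h z) \<partial>lborel) * (\<integral>\<^sup>+y. ennreal (gauss_density S y) \<partial>lborel)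
      = (\<integral>\<^sup>+y. f y \<partial>lborel) * (\<integral>\<^sup>+z. ennreal (gauss_density S (- h z)) \<partial>lborel)"
    by (rule nn_integral_lborel_linear_image[OF lin inv]) (auto simp: f_def)
  then have eq: "ennreal (1 / N * (\<Prod>i\<in>UNIV. sqrt (2 * pi / (1 - 2 * s * l i))))
      = (\<integral>\<^sup>+y. f y \<partial>lborel) * ennreal (1 / N * (\<Prod>i\<in>(UNIV :: 'p set). sqrt (2 * pi / 1)))"
    unfolding Ifh Igh norm using N s
    by (simp only: mult_1_right ennreal_mult prod_nonneg real_sqrt_ge_zero divide_nonneg_nonneg
        less_imp_le zero_le_one pi_ge_zero mult_nonneg_nonneg zero_le_numeral diff_gt_0_iff_gt)
  have "1 / N * (\<Prod>i\<in>UNIV. sqrt (2 * pi / (1 - 2 * s * l i)))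
      = (\<Prod>i\<in>UNIV. 1 / sqrt (1 - 2 * s * l i)) * (1 / N * (\<Prod>i\<in>(UNIV :: 'p set). sqrt (2 * pi / 1)))"
    by (simp add: real_sqrt_divide real_sqrt_mult prod_dividef)
  then have "(\<integral>\<^sup>+y. f y \<partial>lborel) * ennreal (1 / N * (\<Prod>i\<in>(UNIV :: 'p set). sqrt (2 * pi / 1)))
      = ennreal (\<Prod>i\<in>UNIV. 1 / sqrt (1 - 2 * s * l i)) * ennreal (1 / N * (\<Prod>i\<in>(UNIV :: 'p set). sqrt (2 * pi / 1)))"
    unfolding eq[symmetric] using N s by (simp add: prod_nonneg less_imp_le flip: ennreal_mult)
  moreover have "ennreal (1 / N * (\<Prod>i\<in>(UNIV :: 'p set). sqrt (2 * pi / 1))) \<noteq> 0"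
    using N by (simp add: not_le)
  moreover have "x = y" if "x * ennreal c = y * ennreal c" "ennreal c \<noteq> 0" for x y c
    using that mult_divide_eq_ennreal[OF that(2)] by (metis ennreal_neq_top)
  ultimately show ?thesis
    unfolding f_def[symmetric] by blast
qed

text \<open>As the trace is the sum of the \<open>l i\<close>, centering distributes over the
  product, and each factor is bounded by the scalar inequality at x = 2 s \<open>l i\<close>, which
  the bound on s confines to [-K, K].\<close>

lemma centered_mgf_quadratic_form_le:
  assumes norm: "(\<integral>\<^sup>+x. ennreal (gauss_density S x) \<partial>lborel) = 1"
    and s: "\<bar>2 * s\<bar> * eig_norm (A ** S) \<le> K" and K: "K < 1"
  shows "(\<integral>\<^sup>+x. ennreal (gauss_density S x) * ennreal (exp (s * (x \<bullet> (A *v x) - trace (A ** S)))) \<partial>lborel)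
    \<le> ennreal (exp (s\<^sup>2 * (frob_norm (A ** S))\<^sup>2 / (1 - K)))"
proof -
  have sl: "\<bar>2 * s * l i\<bar> \<le> K" for i
    using mult_left_mono[OF abs_le_eig_norm[of i], of "\<bar>2 * s\<bar>"] s by (simp add: abs_mult)
  then have sl1: "2 * s * l i < 1" for i
    using K by (meson abs_le_D1 le_less_trans)
  have "(\<integral>\<^sup>+x. ennreal (gauss_density S x) * ennreal (exp (s * (x \<bullet> (A *v x) - trace (A ** S)))) \<partial>lborel)
      = (\<integral>\<^sup>+x. ennreal (exp (- s * trace (A ** S))) * (ennreal (gauss_density S x) * ennreal (exp (s * (x \<bullet> (A *v x))))) \<partial>lborel)"
    by (intro nn_integral_cong) (simp add: right_diff_distrib exp_diff exp_minus divide_inverse ennreal_mult mult_ac)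
  also have "\<dots> = ennreal (exp (- s * trace (A ** S))) * ennreal (\<Prod>i\<in>UNIV. 1 / sqrt (1 - 2 * s * l i))"
    unfolding mgf_quadratic_form[OF norm sl1, symmetric]
  proof (rule nn_integral_cmult)
    have [measurable]: "(*v) M \<in> borel_measurable borel" for M :: "real^'p^'p"
      by (intro borel_measurable_continuous_onI linear_continuous_on) simp
    show "(\<lambda>x. ennreal (gauss_density S x) * ennreal (exp (s * (x \<bullet> (A *v x))))) \<in> borel_measurable lborel"
      unfolding gauss_density_def by measurable
  qed
  also have "\<dots> = ennreal (\<Prod>i\<in>UNIV. exp (- (2 * s * l i) / 2) / sqrt (1 - 2 * s * l i))"
    using sl1 by (simp add: trace_AS prod_dividef exp_sum[symmetric] sum_negf sum_distrib_left
        prod_nonneg less_imp_le flip: ennreal_mult)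
  also have "\<dots> \<le> ennreal (\<Prod>i\<in>UNIV. exp ((2 * s * l i)\<^sup>2 / (4 * (1 - K))))"
    using sl sl1 K by (intro ennreal_leI prod_mono conjI inverse_sqrt_one_minus_le) (auto simp: less_imp_le)
  also have "\<dots> = ennreal (exp (s\<^sup>2 * (\<Sum>i\<in>UNIV. (l i)\<^sup>2) / (1 - K)))"
  proof -
    have "(2 * s * l i)\<^sup>2 / (4 * (1 - K)) = s\<^sup>2 * (l i)\<^sup>2 / (1 - K)" for i
      using mult_divide_mult_cancel_left[of 4 "s\<^sup>2 * (l i)\<^sup>2" "1 - K"]
      by (simp add: power_mult_distrib mult.assoc)
    then show ?thesis
      by (simp only: sum_distrib_left sum_divide_distrib finite flip: exp_sum)
  qed
  also have "\<dots> \<le> ennreal (exp (s\<^sup>2 * (frob_norm (A ** S))\<^sup>2 / (1 - K)))"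
    using K sum_squares_le_frob_norm by (intro ennreal_leI) (auto intro!: divide_right_mono mult_left_mono)
  finally show ?thesis .
qed

end

section \<open>The sample covariance matrix and the concentration bound\<close>

lemma phi_outer_product: "phi A (\<chi> i j. x $ i * x $ j) = x \<bullet> (A *v x)"
proof -
  have "phi A (\<chi> i j. x $ i * x $ j) = (\<Sum>i\<in>UNIV. \<Sum>k\<in>UNIV. A $ i $ k * (x $ k * x $ i))"
    by (simp add: phi_def trace_def matrix_matrix_mult_def)
  also have "\<dots> = x \<bullet> (A *v x)"
    by (simp add: inner_vec_def matrix_vector_mult_def sum_distrib_left mult_ac)
  finally show ?thesis .
qed

lemma linear_phi: "linear (phi A)"
  by (rule linearI)
     (simp_all add: phi_def trace_def matrix_matrix_mult_def distrib_left sum.distrib sum_distrib_left mult.left_commute)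

text \<open>An average of terms each depending on a single X k, so that independence factors its
  exponential.\<close>

lemma phi_sample_cov:
  assumes "n \<ge> 1"
  shows "phi A (sample_cov n X \<omega> - S)
    = (\<Sum>k=1..n. X k \<omega> \<bullet> (A *v X k \<omega>) - trace (A ** S)) / real n"
proof -
  have "phi A (sample_cov n X \<omega>) = (\<Sum>k=1..n. X k \<omega> \<bullet> (A *v X k \<omega>)) / real n"
    by (simp add: sample_cov_def linear_scale[OF linear_phi] linear_sum[OF linear_phi] phi_outer_product)
  then show ?thesis
    using assms by (simp add: linear_diff[OF linear_phi] phi_def[of A S] sum_subtractf diff_divide_distrib)
qed

theorem theorem2p2:
  fixes M :: "'a measure"
    and n :: nat
    and X :: "nat \<Rightarrow> 'a \<Rightarrow> real^'p"
    and A \<Sigma> :: "real^'p^'p"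
    and K :: real
  assumes "prob_space M"
    and "n \<ge> 1"
    and "pos_def_mat \<Sigma>"
    and "prob_space.indep_vars M (\<lambda>_. borel) X {1..n}"
    and "\<And>k. k \<in> {1..n} \<Longrightarrow> distributed M lborel (X k) (\<lambda>x. ennreal (gauss_density \<Sigma> x))"
    and "symmetric_mat A" and "A \<noteq> 0"
    and "0 < K" and "K < 1"
  shows "let nu2 = 2 * (frob_norm (A ** \<Sigma>))\<^sup>2 / (real n * (1 - K));
             b = 2 * eig_norm (A ** \<Sigma>) / (real n * K);
             t = (\<lambda>u. max (sqrt u * (frob_norm (A ** \<Sigma>) / sqrt (real n * (1 - K))))
                          (u * (eig_norm (A ** \<Sigma>) / (real n * K))))
         in centered M (\<lambda>\<omega>. phi A (sample_cov n X \<omega> - \<Sigma>))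
          \<and> sub_exponential M (\<lambda>\<omega>. phi A (sample_cov n X \<omega> - \<Sigma>)) nu2 b
          \<and> centered M (\<lambda>\<omega>. phi A (\<Sigma> - sample_cov n X \<omega>))
          \<and> sub_exponential M (\<lambda>\<omega>. phi A (\<Sigma> - sample_cov n X \<omega>)) nu2 b
          \<and> (\<forall>u>0. measure M {\<omega> \<in> space M. phi A (sample_cov n X \<omega> - \<Sigma>) \<ge> t u} \<le> exp (- u / 4))"
proof -
  interpret prob_space M by fact
  obtain e :: "'p \<Rightarrow> real^'p" and l :: "'p \<Rightarrow> real"
    where e: "\<And>i j. e i \<bullet> (\<Sigma> *v e j) = (if i = j then 1 else 0)"
      "\<And>i. A *v (\<Sigma> *v e i) = l i *\<^sub>R e i" "span (range e) = UNIV"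
    using simultaneous_diagonalization[OF assms(3,6)] by blast
  interpret simultaneous_eigenbasis \<Sigma> A e l
    by unfold_locales (fact assms(3) assms(6) e)+
  define F where "F = frob_norm (A ** \<Sigma>)"
  define E where "E = eig_norm (A ** \<Sigma>)"
  define nu2 where "nu2 = 2 * F\<^sup>2 / (real n * (1 - K))"
  define b where "b = 2 * E / (real n * K)"
  define Z where "Z \<omega> = phi A (sample_cov n X \<omega> - \<Sigma>)" for \<omega>
  have n: "0 < real n" using \<open>n \<ge> 1\<close> by simp
  \<comment> \<open>One nonzero eigenvalue makes both norms, and hence both parameters,
    positive.\<close>
  obtain i where i: "l i \<noteq> 0" using eigenvalue_nonzero[OF \<open>A \<noteq> 0\<close>] .
  have "0 < E" using i abs_le_eig_norm[of i] by (simp add: E_def)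
  have "0 < (\<Sum>i\<in>UNIV. (l i)\<^sup>2)"
    using i by (intro sum_pos2[of _ i]) auto
  then have "0 < F\<^sup>2"
    unfolding F_def using sum_squares_le_frob_norm by (rule less_le_trans)
  have "0 \<le> F"
    unfolding F_def frob_norm_def trace_def matrix_matrix_mult_def transpose_def
    by (auto intro!: sum_nonneg)
  have b: "0 < b" and nu2: "0 < nu2"
    using \<open>0 < E\<close> \<open>0 < F\<^sup>2\<close> n assms(8,9) by (simp_all add: b_def nu2_def)

  define Y where "Y s x = ennreal (exp (s * (x \<bullet> (A *v x) - trace (A ** \<Sigma>))))" for s and x :: "real^'p"
  have [measurable]: "(*v) A \<in> borel_measurable borel"
    by (intro borel_measurable_continuous_onI linear_continuous_on) simp
  have [measurable]: "Y s \<in> borel_measurable borel" for s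
    unfolding Y_def by measurable
  have [measurable]: "X k \<in> borel_measurable M" if "k \<in> {1..n}" for k
    using assms(4) that by (simp add: indep_vars_def)
  have Z_eq: "Z \<omega> = (\<Sum>k=1..n. X k \<omega> \<bullet> (A *v X k \<omega>) - trace (A ** \<Sigma>)) / real n" for \<omega>
    unfolding Z_def by (rule phi_sample_cov) fact
  have Z_meas: "Z \<in> borel_measurable M"
    unfolding Z_eq[abs_def] by measurable
  have transfer: "(\<integral>\<^sup>+\<omega>. f (X k \<omega>) \<partial>M) = (\<integral>\<^sup>+x. ennreal (gauss_density \<Sigma> x) * f x \<partial>lborel)"
    if "k \<in> {1..n}" "f \<in> borel_measurable borel" for k f
    using distributed_nn_integral[OF assms(5)[OF that(1)], of f] that(2) by simp
  \<comment> \<open>The law of X 1 is a probability measure; n \<ge> 1 provides this vector.\<close>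
  have norm: "(\<integral>\<^sup>+x. ennreal (gauss_density \<Sigma> x) \<partial>lborel) = 1"
    using transfer[of 1 "\<lambda>_. 1"] \<open>n \<ge> 1\<close> by (simp add: emeasure_space_1)

  have sub: "sub_exponential M Z nu2 b"
  proof (rule sub_exponentialI[OF assms(1) Z_meas nu2 b])
    fix t assume "\<bar>t\<bar> \<le> 1 / b"
    \<comment> \<open>The bound 1/b is n K / (2 E), so each summand is evaluated at s = t/n with 2
      |s| E \<le> K.\<close>
    then have t: "\<bar>2 * (t / real n)\<bar> * eig_norm (A ** \<Sigma>) \<le> K"
      using n \<open>0 < E\<close> \<open>0 < K\<close> by (simp add: b_def E_def field_simps abs_mult)
    have "(\<integral>\<^sup>+\<omega>. ennreal (exp (t * Z \<omega>)) \<partial>M) = (\<integral>\<^sup>+\<omega>. (\<Prod>k=1..n. Y (t / real n) (X k \<omega>)) \<partial>M)"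
      by (intro nn_integral_cong)
         (simp add: Z_eq Y_def prod_ennreal sum_distrib_left sum_divide_distrib flip: exp_sum)
    also have "\<dots> = (\<Prod>k=1..n. \<integral>\<^sup>+\<omega>. Y (t / real n) (X k \<omega>) \<partial>M)"
      by (intro indep_vars_nn_integral indep_vars_compose2[OF assms(4)]) auto
    also have "\<dots> \<le> (\<Prod>k=1..n. ennreal (exp ((t / real n)\<^sup>2 * F\<^sup>2 / (1 - K))))"
    proof (intro prod_mono_ennreal)
      fix k assume "k \<in> {1..n}"
      then have "(\<integral>\<^sup>+\<omega>. Y (t / real n) (X k \<omega>) \<partial>M)
          = (\<integral>\<^sup>+x. ennreal (gauss_density \<Sigma> x) * Y (t / real n) x \<partial>lborel)"
        by (intro transfer) auto
      also have "\<dots> \<le> ennreal (exp ((t / real n)\<^sup>2 * F\<^sup>2 / (1 - K)))"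
        unfolding F_def Y_def by (rule centered_mgf_quadratic_form_le[OF norm t \<open>K < 1\<close>])
      finally show "(\<integral>\<^sup>+\<omega>. Y (t / real n) (X k \<omega>) \<partial>M) \<le> ennreal (exp ((t / real n)\<^sup>2 * F\<^sup>2 / (1 - K)))" .
    qed
    also have "\<dots> = ennreal (exp (real n * ((t / real n)\<^sup>2 * F\<^sup>2 / (1 - K))))"
      by (simp add: ennreal_power exp_of_nat_mult del: times_divide_eq_right)
    \<comment> \<open>Of the two factors 1/n in s^2, the n independent summands cancel one; the
      other stays in \<open>nu2\<close>.\<close>
    also have "real n * ((t / real n)\<^sup>2 * F\<^sup>2 / (1 - K)) = nu2 * t\<^sup>2 / 2"
      using n \<open>K < 1\<close> by (simp add: nu2_def divide_simps) (simp add: power2_eq_square)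
    finally show "(\<integral>\<^sup>+\<omega>. ennreal (exp (t * Z \<omega>)) \<partial>M) \<le> ennreal (exp (nu2 * t\<^sup>2 / 2))" .
  qed
  have neg: "phi A (\<Sigma> - sample_cov n X \<omega>) = - Z \<omega>" for \<omega>
    unfolding Z_def by (simp flip: linear_neg[OF linear_phi])
  have "measure M {\<omega> \<in> space M. Z \<omega> \<ge> max (sqrt u * (F / sqrt (real n * (1 - K)))) (u * (E / (real n * K)))}
      \<le> exp (- u / 4)" if "0 < u" for u
  proof -
    \<comment> \<open>The tail lemma is used at v = u/2, which absorbs the factors 2 in
      \<open>nu2\<close> and \<open>b\<close> and turns exp (-v/2) into exp (-u/4).\<close>
    have "nu2 * (u / 2) = u * (F\<^sup>2 / (real n * (1 - K)))"
      by (simp add: nu2_def)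
    then have "sqrt (nu2 * (u / 2)) = sqrt u * (F / sqrt (real n * (1 - K)))"
      using \<open>0 \<le> F\<close> by (simp add: real_sqrt_mult real_sqrt_divide)
    moreover have "b * (u / 2) = u * (E / (real n * K))"
      by (simp add: b_def)
    ultimately show ?thesis
      using sub_exponential_tail[OF assms(1) sub, of "u / 2"] that by simp
  qed
  then show ?thesis
    using sub sub_exponential_uminus[OF sub]
    unfolding Let_def neg Z_def[symmetric] F_def[symmetric] E_def[symmetric]
      nu2_def[symmetric] b_def[symmetric]
    by (auto simp: sub_exponential_def)
qed

end
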